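(* Let $(A,\cdot,\alpha)$ be a Hom-associative algebra and let $(V,l,r,\beta)$ be a bimodule of $A$. A linear map $\mathcal K:V\to A$ is a relative averaging operator on $A$ with respect to $(V,l,r,\beta)$ if and only if the map $N_{\mathcal K}:A\oplus V\to A\oplus V$, $x+u\mapsto \mathcal K(u)$ (for $x\in A$, $u\in V$), is a Nijenhuis operator on the hemisemi-direct product Hom-associative dialgebra $A\oplus_{Diass}V$.
   Context: All vector spaces are over a field $\mathbb K$ of characteristic $0$. All Hom-algebras are multiplicative, i.e. the twisting map preserves every bilinear operation of the structure. A Hom-associative algebra $(A,\cdot,\alpha)$ is a vector space $A$ with a bilinear operation $\cdot$ and a linear map $\alpha:A\to A$ such that $(x\cdot y)\cdot\alpha(z)=\alpha(x)\cdot(y\cdot z)$ for all $x,y,z\in A$. A bimodule $(V,l,r,\beta)$ of $(A,\cdot,\alpha)$ is a vector space $V$ with a linear map $\beta:V\to V$ and linear maps $l,r:A\to \mathrm{End}(V)$ such that for all $x,y\in A$: $\beta l(x)=l(\alpha(x))\beta$, $\beta r(x)=r(\alpha(x))\beta$, $l(x\cdot y)\beta=l(\alpha(x))l(y)$, $r(x\cdot y)\beta=r(\alpha(y))r(x)$, $l(\alpha(x))r(y)=r(\alpha(y))l(x)$. A linear map $\mathcal K:V\to A$ is a relative averaging operator on $A$ with respect to $(V,l,r,\beta)$ if $\mathcal K\beta=\alpha\mathcal K$ and $\mathcal K(u)\cdot\mathcal K(v)=\mathcal K(l(\mathcal K(u))v)=\mathcal K(r(\mathcal K(v))u)$ for all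 $u,v\in V$. The hemisemi-direct product $A\oplus_{Diass}V$ is the Hom-associative dialgebra on $A\oplus V$ with, for $x,y\in A$, $u,v\in V$: $(x+u)\vdash_{A\oplus V}(y+v)=x\cdot y+l(x)v$, $(x+u)\dashv_{A\oplus V}(y+v)=x\cdot y+r(y)u$, and twisting map $\alpha_{A\oplus V}(x+u)=\alpha(x)+\beta(u)$. A linear map $N:B\to B$ on a Hom-algebra $B$ with twisting map $\alpha_B$ is a Nijenhuis operator if $N\alpha_B=\alpha_B N$ and, for each bilinear operation $\mu$ of $B$ (here both $\vdash_{A\oplus V}$ and $\dashv_{A\oplus V}$), $\mu(N(X),N(Y))=N\big(\mu(N(X),Y)+\mu(X,N(Y))-N\mu(X,Y)\big)$ for all $X,Y\in B$. *)

theory Defs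
  imports "HOL-Analysis.Product_Vector"
begin

definition bilinear_map ::
  "('k::field_char_0 \<Rightarrow> 'a::ab_group_add \<Rightarrow> 'a) \<Rightarrow> ('k \<Rightarrow> 'b::ab_group_add \<Rightarrow> 'b) \<Rightarrow>
   ('k \<Rightarrow> 'c::ab_group_add \<Rightarrow> 'c) \<Rightarrow> ('a \<Rightarrow> 'b \<Rightarrow> 'c) \<Rightarrow> bool"
  where "bilinear_map s1 s2 s3 f \<longleftrightarrow>
    (\<forall>x. Vector_Spaces.linear s2 s3 (f x)) \<and> (\<forall>y. Vector_Spaces.linear s1 s3 (\<lambda>x. f x y))"

text \<open>A Hom-algebra is given by its scalar multiplication, the set of its bilinear operations and
  its twisting map; it is always multiplicative here.\<close>

locale hom_algebra = vector_space scl
  for scl :: "'k::field_char_0 \<Rightarrow> 'a::ab_group_add \<Rightarrow> 'a" +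
  fixes ops :: "('a \<Rightarrow> 'a \<Rightarrow> 'a) set" and \<alpha> :: "'a \<Rightarrow> 'a"
  assumes linear_twist: "Vector_Spaces.linear scl scl \<alpha>"
    and bilinear_ops: "\<mu> \<in> ops \<Longrightarrow> bilinear_map scl scl scl \<mu>"
    and multiplicative: "\<mu> \<in> ops \<Longrightarrow> \<alpha> (\<mu> x y) = \<mu> (\<alpha> x) (\<alpha> y)"

locale hom_associative_algebra = hom_algebra scl "{mult}" \<alpha>
  for scl :: "'k::field_char_0 \<Rightarrow> 'a::ab_group_add \<Rightarrow> 'a"
    and mult :: "'a \<Rightarrow> 'a \<Rightarrow> 'a" and \<alpha> :: "'a \<Rightarrow> 'a" +
  assumes hom_assoc: "mult (mult x y) (\<alpha> z) = mult (\<alpha> x) (mult y z)"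

locale hom_associative_dialgebra = hom_algebra scl "{vdash, dashv}" \<alpha>
  for scl :: "'k::field_char_0 \<Rightarrow> 'a::ab_group_add \<Rightarrow> 'a"
    and vdash dashv :: "'a \<Rightarrow> 'a \<Rightarrow> 'a" and \<alpha> :: "'a \<Rightarrow> 'a" +
  assumes vdash_assoc: "vdash (vdash x y) (\<alpha> z) = vdash (\<alpha> x) (vdash y z)"
    and dashv_assoc: "dashv (dashv x y) (\<alpha> z) = dashv (\<alpha> x) (dashv y z)"
    and inner_assoc: "dashv (vdash x y) (\<alpha> z) = vdash (\<alpha> x) (dashv y z)"
    and vdash_bar: "vdash (dashv x y) (\<alpha> z) = vdash (vdash x y) (\<alpha> z)"
    and dashv_bar: "dashv (\<alpha> x) (vdash y z) = dashv (\<alpha> x) (dashv y z)"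

text \<open>Linear maps \<open>A \<rightarrow> End(V)\<close> are represented by their curried bilinear maps: \<open>l x v\<close> and
  \<open>r x v\<close> stand for \<open>l(x)v\<close> and \<open>r(x)v\<close>, the algebra element being the first argument
  also for \<open>r\<close>.\<close>

locale hom_bimodule = hom_associative_algebra scaleA mult \<alpha> + V: vector_space scaleV
  for scaleA :: "'k::field_char_0 \<Rightarrow> 'a::ab_group_add \<Rightarrow> 'a"
    and mult :: "'a \<Rightarrow> 'a \<Rightarrow> 'a" and \<alpha> :: "'a \<Rightarrow> 'a"
    and scaleV :: "'k \<Rightarrow> 'v::ab_group_add \<Rightarrow> 'v" +
  fixes l r :: "'a \<Rightarrow> 'v \<Rightarrow> 'v" and \<beta> :: "'v \<Rightarrow> 'v"
  assumes linear_\<beta>: "Vector_Spaces.linear scaleV scaleV \<beta>"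
    and bilinear_l: "bilinear_map scaleA scaleV scaleV l"
    and bilinear_r: "bilinear_map scaleA scaleV scaleV r"
    and \<beta>_l: "\<beta> \<circ> l x = l (\<alpha> x) \<circ> \<beta>"
    and \<beta>_r: "\<beta> \<circ> r x = r (\<alpha> x) \<circ> \<beta>"
    and l_mult: "l (mult x y) \<circ> \<beta> = l (\<alpha> x) \<circ> l y"
    and r_mult: "r (mult x y) \<circ> \<beta> = r (\<alpha> y) \<circ> r x"
    and l_r: "l (\<alpha> x) \<circ> r y = r (\<alpha> y) \<circ> l x"

definition relative_averaging_operator ::
  "('k::field_char_0 \<Rightarrow> 'a::ab_group_add \<Rightarrow> 'a) \<Rightarrow> ('a \<Rightarrow> 'a \<Rightarrow> 'a) \<Rightarrow> ('a \<Rightarrow> 'a) \<Rightarrow>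
   ('k \<Rightarrow> 'v::ab_group_add \<Rightarrow> 'v) \<Rightarrow> ('a \<Rightarrow> 'v \<Rightarrow> 'v) \<Rightarrow> ('a \<Rightarrow> 'v \<Rightarrow> 'v) \<Rightarrow> ('v \<Rightarrow> 'v) \<Rightarrow>
   ('v \<Rightarrow> 'a) \<Rightarrow> bool"
  where "relative_averaging_operator scaleA mult \<alpha> scaleV l r \<beta> K \<longleftrightarrow>
    Vector_Spaces.linear scaleV scaleA K \<and>
    K \<circ> \<beta> = \<alpha> \<circ> K \<and>
    (\<forall>u v. mult (K u) (K v) = K (l (K u) v) \<and> K (l (K u) v) = K (r (K v) u))"

definition nijenhuis_operator ::
  "('k::field_char_0 \<Rightarrow> 'b::ab_group_add \<Rightarrow> 'b) \<Rightarrow> ('b \<Rightarrow> 'b \<Rightarrow> 'b) set \<Rightarrow> ('b \<Rightarrow> 'b) \<Rightarrow>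
   ('b \<Rightarrow> 'b) \<Rightarrow> bool"
  where "nijenhuis_operator scl ops \<alpha> N \<longleftrightarrow>
    Vector_Spaces.linear scl scl N \<and>
    N \<circ> \<alpha> = \<alpha> \<circ> N \<and>
    (\<forall>\<mu>\<in>ops. \<forall>X Y. \<mu> (N X) (N Y) = N (\<mu> (N X) Y + \<mu> X (N Y) - N (\<mu> X Y)))"

text \<open>The direct sum \<open>A \<oplus> V\<close> is the product type \<open>'a \<times> 'v\<close> with componentwise scalar
  multiplication, and \<open>x + u\<close> is the pair \<open>(x, u)\<close>.\<close>

abbreviation dsum_scale ::
  "('k::field_char_0 \<Rightarrow> 'a::ab_group_add \<Rightarrow> 'a) \<Rightarrow> ('k \<Rightarrow> 'v::ab_group_add \<Rightarrow> 'v) \<Rightarrow>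
   'k \<Rightarrow> 'a \<times> 'v \<Rightarrow> 'a \<times> 'v"
  where "dsum_scale scaleA scaleV \<equiv> module_prod.scale scaleA scaleV"

fun hemisemi_vdash :: "('a \<Rightarrow> 'a \<Rightarrow> 'a) \<Rightarrow> ('a \<Rightarrow> 'v \<Rightarrow> 'v) \<Rightarrow> 'a \<times> 'v \<Rightarrow> 'a \<times> 'v \<Rightarrow> 'a \<times> 'v"
  where "hemisemi_vdash mult l (x, u) (y, v) = (mult x y, l x v)"

fun hemisemi_dashv :: "('a \<Rightarrow> 'a \<Rightarrow> 'a) \<Rightarrow> ('a \<Rightarrow> 'v \<Rightarrow> 'v) \<Rightarrow> 'a \<times> 'v \<Rightarrow> 'a \<times> 'v \<Rightarrow> 'a \<times> 'v"
  where "hemisemi_dashv mult r (x, u) (y, v) = (mult x y, r y u)"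

fun hemisemi_twist :: "('a \<Rightarrow> 'a) \<Rightarrow> ('v \<Rightarrow> 'v) \<Rightarrow> 'a \<times> 'v \<Rightarrow> 'a \<times> 'v"
  where "hemisemi_twist \<alpha> \<beta> (x, u) = (\<alpha> x, \<beta> u)"

fun lift_op :: "('v \<Rightarrow> 'a) \<Rightarrow> 'a \<times> 'v \<Rightarrow> 'a \<times> 'v::zero"
  where "lift_op K (x, u) = (K u, 0)"

context hom_bimodule
begin

lemma vector_space_prod: "vector_space_prod scaleA scaleV"
  by (simp add: vector_space_prod_def vector_space_pair_def vector_space_axioms V.vector_space_axioms)

lemma dsum_scale_Pair: "dsum_scale scaleA scaleV c (x, u) = (scaleA c x, scaleV c u)"
proof -
  interpret vector_space_prod scaleA scaleV by (rule vector_space_prod)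
  show ?thesis by (rule scale_prod)
qed

lemma vector_space_dsum: "vector_space (dsum_scale scaleA scaleV)"
proof -
  interpret vector_space_prod scaleA scaleV by (rule vector_space_prod)
  show ?thesis by (rule p.vector_space_axioms)
qed

theorem hemisemi_direct_product:
  "hom_associative_dialgebra (dsum_scale scaleA scaleV)
     (hemisemi_vdash mult l) (hemisemi_dashv mult r) (hemisemi_twist \<alpha> \<beta>)"
proof -
  let ?s = "dsum_scale scaleA scaleV"
  note lin = Vector_Spaces.linear_iff dsum_scale_Pair
  have mult_bil: "bilinear_map scaleA scaleA scaleA mult"
    and mult_twist: "\<And>x y. \<alpha> (mult x y) = mult (\<alpha> x) (\<alpha> y)"
    using bilinear_ops multiplicative by auto
  note bil = mult_bil[unfolded bilinear_map_def lin] bilinear_l[unfolded bilinear_map_def lin]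
    bilinear_r[unfolded bilinear_map_def lin]
  have t: "Vector_Spaces.linear ?s ?s (hemisemi_twist \<alpha> \<beta>)"
    using linear_twist linear_\<beta> vector_space_dsum by (auto simp: lin)
  have L: "bilinear_map ?s ?s ?s (hemisemi_vdash mult l)"
    and R: "bilinear_map ?s ?s ?s (hemisemi_dashv mult r)"
    using bil vector_space_dsum by (auto simp: bilinear_map_def lin)
  note act = \<beta>_l \<beta>_r l_mult r_mult l_r
  note act' = act[THEN fun_cong, unfolded o_apply]
  show ?thesis
    unfolding hom_associative_dialgebra_def hom_associative_dialgebra_axioms_def
      hom_algebra_def hom_algebra_axioms_def
    using vector_space_dsum t L R
    by (auto simp: mult_twist hom_assoc act')
qed

end

end

theory Submission
  imports Defs
begin

text \<open>The map \<open>N = lift_op K\<close> sends \<open>A \<oplus> V\<close> into \<open>A\<close> and kills \<open>A\<close>, so \<open>N \<circ> N = 0\<close> and \<open>N\<close>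
  sees only the \<open>V\<close>-component of its argument. In the Nijenhuis identity the term
  \<open>N (N (\<mu> X Y))\<close> therefore vanishes, and of \<open>N (\<mu> (N X) Y + \<mu> X (N Y))\<close> only the
  \<open>V\<close>-components of the two products matter. One of these is an action on the zero vector: for
  \<open>\<turnstile>\<close> only \<open>l (K u) v\<close> survives, for \<open>\<stileturn>\<close> only \<open>r (K v) u\<close>. So the two Nijenhuis identities
  are precisely the two averaging identities, and the same projection to components identifies
  commutation of \<open>N\<close> with the twisting map and \<open>K \<circ> \<beta> = \<alpha> \<circ> K\<close>.\<close>

lemma linear_lift_op:
  assumes "vector_space (dsum_scale scaleA scaleV)"
    and "\<And>c x u. dsum_scale scaleA scaleV c (x, u) = (scaleA c x, scaleV c u)"
    and "Vector_Spaces.linear scaleV scaleA K"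
  shows "Vector_Spaces.linear (dsum_scale scaleA scaleV) (dsum_scale scaleA scaleV) (lift_op K)"
proof -
  interpret K: Vector_Spaces.linear scaleV scaleA K by fact
  show ?thesis
    using assms(1) by (auto simp: Vector_Spaces.linear_iff assms(2) K.add K.scale)
qed

lemma lift_op_comm_twist_iff:
  assumes "\<beta> 0 = 0"
  shows "lift_op K \<circ> hemisemi_twist \<alpha> \<beta> = hemisemi_twist \<alpha> \<beta> \<circ> lift_op K \<longleftrightarrow> K \<circ> \<beta> = \<alpha> \<circ> K"
  using assms by (auto simp: fun_eq_iff)

text \<open>With \<open>X = (x, u)\<close> and \<open>Y = (y, v)\<close>, the product \<open>\<mu> X (N Y)\<close> has \<open>V\<close>-component
  \<open>l x 0 = 0\<close>, and \<open>N (N (\<mu> X Y)) = 0\<close> because \<open>K 0 = 0\<close>. What remains is free of \<open>x\<close> and \<open>y\<close>,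
  so quantifying over \<open>X\<close> and \<open>Y\<close> amounts to quantifying over \<open>u\<close> and \<open>v\<close>.\<close>

lemma nijenhuis_vdash_iff:
  fixes mult :: "'a::ab_group_add \<Rightarrow> 'a \<Rightarrow> 'a"
    and l :: "'a \<Rightarrow> 'v::ab_group_add \<Rightarrow> 'v"
  assumes "K 0 = 0" and "\<And>x. l x 0 = 0"
  defines "N \<equiv> lift_op K" and "\<mu> \<equiv> hemisemi_vdash mult l"
  shows "(\<forall>X Y. \<mu> (N X) (N Y) = N (\<mu> (N X) Y + \<mu> X (N Y) - N (\<mu> X Y))) \<longleftrightarrow>
    (\<forall>u v. mult (K u) (K v) = K (l (K u) v))"
  using assms by auto

text \<open>The roles are exchanged: now \<open>\<mu> (N X) Y\<close> has \<open>V\<close>-component \<open>r y 0 = 0\<close>, because \<open>\<stileturn>\<close>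
  lets its second argument act on the first.\<close>

lemma nijenhuis_dashv_iff:
  fixes mult :: "'a::ab_group_add \<Rightarrow> 'a \<Rightarrow> 'a"
    and r :: "'a \<Rightarrow> 'v::ab_group_add \<Rightarrow> 'v"
  assumes "K 0 = 0" and "\<And>x. r x 0 = 0"
  defines "N \<equiv> lift_op K" and "\<mu> \<equiv> hemisemi_dashv mult r"
  shows "(\<forall>X Y. \<mu> (N X) (N Y) = N (\<mu> (N X) Y + \<mu> X (N Y) - N (\<mu> X Y))) \<longleftrightarrow>
    (\<forall>u v. mult (K u) (K v) = K (r (K v) u))"
  using assms by auto

theorem proposition3p7:
  fixes scaleA :: "'k::field_char_0 \<Rightarrow> 'a::ab_group_add \<Rightarrow> 'a"
    and scaleV :: "'k \<Rightarrow> 'v::ab_group_add \<Rightarrow> 'v"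
    and mult :: "'a \<Rightarrow> 'a \<Rightarrow> 'a" and \<alpha> :: "'a \<Rightarrow> 'a"
    and l r :: "'a \<Rightarrow> 'v \<Rightarrow> 'v" and \<beta> :: "'v \<Rightarrow> 'v"
    and K :: "'v \<Rightarrow> 'a"
  assumes "hom_associative_algebra scaleA mult \<alpha>"
    and "hom_bimodule scaleA mult \<alpha> scaleV l r \<beta>"
    and "Vector_Spaces.linear scaleV scaleA K"
  shows "relative_averaging_operator scaleA mult \<alpha> scaleV l r \<beta> K \<longleftrightarrow>
    nijenhuis_operator (dsum_scale scaleA scaleV)
      {hemisemi_vdash mult l, hemisemi_dashv mult r} (hemisemi_twist \<alpha> \<beta>) (lift_op K)"
proof -
  interpret hom_bimodule scaleA mult \<alpha> scaleV l r \<beta> by fact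
  interpret K: Vector_Spaces.linear scaleV scaleA K by fact
  interpret \<beta>: Vector_Spaces.linear scaleV scaleV \<beta> by (rule linear_\<beta>)
  have l0: "l x 0 = 0" for x
  proof -
    interpret lx: Vector_Spaces.linear scaleV scaleV "l x"
      using bilinear_l by (simp add: bilinear_map_def)
    show ?thesis by (rule lx.zero)
  qed
  have r0: "r x 0 = 0" for x
  proof -
    interpret rx: Vector_Spaces.linear scaleV scaleV "r x"
      using bilinear_r by (simp add: bilinear_map_def)
    show ?thesis by (rule rx.zero)
  qed
  have "nijenhuis_operator (dsum_scale scaleA scaleV)
      {hemisemi_vdash mult l, hemisemi_dashv mult r} (hemisemi_twist \<alpha> \<beta>) (lift_op K) \<longleftrightarrow>
    K \<circ> \<beta> = \<alpha> \<circ> K \<and> (\<forall>u v. mult (K u) (K v) = K (l (K u) v)) \<and>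
    (\<forall>u v. mult (K u) (K v) = K (r (K v) u))"
    by (simp only: nijenhuis_operator_def ball_simps simp_thms
        linear_lift_op[OF vector_space_dsum dsum_scale_Pair assms(3)]
        lift_op_comm_twist_iff[of \<beta>, OF \<beta>.zero]
        nijenhuis_vdash_iff[of K l, OF K.zero l0] nijenhuis_dashv_iff[of K r, OF K.zero r0])
  also have "\<dots> \<longleftrightarrow> relative_averaging_operator scaleA mult \<alpha> scaleV l r \<beta> K"
    using assms(3) by (auto simp: relative_averaging_operator_def)
  finally show ?thesis ..
qed

end
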